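(* Let $k\in\mathbb{N}$ ($k\ge 1$), $\tilde\epsilon>0$ and $\xi\in(\frac{\pi}{2}+\tilde\epsilon,\frac{3\pi}{2}-\tilde\epsilon)$ be fixed, and let $\beta=e^{i\xi}$. Let $\{\alpha_n\}_{n\ge 0}$ be a sequence of real Verblunsky coefficients (so $\alpha_n\in(-1,1)$) having slow decay controlled by $f$. Let $\zeta^{(M)}_1,\dots,\zeta^{(M)}_M$ be the zeros of the paraorthogonal polynomial $\Phi_M^{(\beta)}$, ordered counterclockwise starting from $1$. Then for each $\delta>0$ there exists $N_k=N_k(\delta)\in\mathbb{N}$, $N_k\geq k$, such that for every integer $M>N_k$, \[ \left|\frac{\arg\left(\zeta_k^{(M)}\right)}{2|f(M)|}-1\right|<\delta \qquad\text{and}\qquad \left|\frac{2\pi-\arg\left(\zeta_{M-k+1}^{(M)}\right)}{2|f(M)|}-1\right|<\delta . \]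
   Context: Let $\mathbb{D}=\{z\in\mathbb{C}:|z|<1\}$. Given Verblunsky coefficients $\{\alpha_n\}_{n\ge0}\subset\mathbb{D}$, the monic orthogonal polynomials on the unit circle are defined by $\Phi_0=1$ and the Szegő recursion $\Phi_{n+1}(z)=z\Phi_n(z)-\overline{\alpha}_n\Phi_n^*(z)$, where $\Phi_n^*(z)=z^n\overline{\Phi_n(1/\bar z)}$. (These are the monic orthogonal polynomials of the unique probability measure on $\partial\mathbb{D}$ with infinite support having these Verblunsky coefficients.) For $\beta\in\partial\mathbb{D}$ and $n\ge1$, the paraorthogonal polynomial is $\Phi_n^{(\beta)}(z)=z\Phi_{n-1}(z)-\overline{\beta}\,\Phi_{n-1}^*(z)$. It is known that its $n$ zeros are simple and lie on $\partial\mathbb{D}$; they are denoted $\zeta_1^{(n)},\dots,\zeta_n^{(n)}$, ordered counterclockwise starting from $1$, i.e. with $\arg$ taking values in $[0,2\pi)$, $0\le\arg\zeta_1^{(n)}<\dots<\arg\zeta_n^{(n)}<2\pi$. A sequence of Verblunsky coefficients $\{\alpha_n\}_{n\ge0}$ has slow decay controlled by $f$ if $f$ is a non-positive function $f(n)$ of the positive integers (non-integer arguments such as $n-k\sqrt n$ are replaced by the closest integer) such that: (i) either $f(n)=-Cn^{-b}$ for some $b\in(0,1)$ and $C>0$, or $\lim_{n\to\infty}\sqrt n\,f(n-\sqrt n)^2=\infty$; (ii) $f(n)<f(n+1)<0$ for all $n>0$ and $\lim_{n\to\infty}f(n)=0$; (iii) $\lim_{n\to\infty}\frac{f(n-k\sqrt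 n)}{f(n)}=1$ for all $k\in\mathbb{N}$; (iv) $\lim_{n\to\infty}\frac{\alpha_n}{f(n)}=1$; (v) there is $m_0$ such that $\mathrm{Re}[\alpha_n]\le f(m)$ whenever $m\ge m_0$ and $0\le n\le m$. *)

theory Defs
  imports "HOL-Analysis.Analysis" "HOL-Computational_Algebra.Polynomial"
begin

text \<open>The reversal relative to the nominal degree \<open>n\<close>. It is given on coefficients, so that it
  also makes sense at \<open>z = 0\<close>; away from \<open>0\<close> it is \<open>z ^ n * cnj (p (1 / cnj z))\<close>.\<close>

definition szego_dual :: "nat \<Rightarrow> complex poly \<Rightarrow> complex poly" where
  "szego_dual n p = (\<Sum>i\<le>n. monom (cnj (coeff p i)) (n - i))"

lemma poly_szego_dual:
  assumes "degree p \<le> n" "z \<noteq> 0"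
  shows "poly (szego_dual n p) z = z ^ n * cnj (poly p (1 / cnj z))"
proof -
  have "poly p w = (\<Sum>i\<le>n. coeff p i * w ^ i)" for w
    unfolding poly_altdef
    by (rule sum.mono_neutral_left) (use assms in \<open>auto simp: coeff_eq_0\<close>)
  then show ?thesis
    using assms(2)
    by (auto simp: szego_dual_def poly_sum poly_monom sum_distrib_left power_diff
        power_one_over field_simps intro!: sum.cong)
qed

fun opuc :: "(nat \<Rightarrow> complex) \<Rightarrow> nat \<Rightarrow> complex poly" where
  "opuc \<alpha> 0 = 1"
| "opuc \<alpha> (Suc n) = [:0, 1:] * opuc \<alpha> n - smult (cnj (\<alpha> n)) (szego_dual n (opuc \<alpha> n))"

text \<open>Only meaningful for \<open>n \<ge> 1\<close>.\<close>

definition popuc :: "(nat \<Rightarrow> complex) \<Rightarrow> complex \<Rightarrow> nat \<Rightarrow> complex poly" where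
  "popuc \<alpha> \<beta> n =
     [:0, 1:] * opuc \<alpha> (n - 1) - smult (cnj \<beta>) (szego_dual (n - 1) (opuc \<alpha> (n - 1)))"

text \<open>The zeros of \<open>p\<close>, without multiplicity, sorted by argument in \<open>[0, 2\<pi>)\<close>. This is the intended
  enumeration when no two zeros have the same argument, in particular when all of them lie on
  the unit circle.\<close>

definition zeros_ccw :: "complex poly \<Rightarrow> complex list" where
  "zeros_ccw p = sorted_key_list_of_set Arg2pi {z. poly p z = 0}"

lemma (in linorder) sorted_key_list_of_set_inj_on:
  assumes "finite A" "inj_on f A"
  shows "set (sorted_key_list_of_set f A) = A"
    and "sorted_wrt (<) (map f (sorted_key_list_of_set f A))"
proof -
  interpret folding_insort_key "(\<le>)" "(<)" A f
    by unfold_locales (rule assms(2))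
  show "set (sorted_key_list_of_set f A) = A"
    using assms(1) by simp
  show "sorted_wrt (<) (map f (sorted_key_list_of_set f A))"
    by simp
qed

lemma zeros_ccw:
  assumes "p \<noteq> 0" "inj_on Arg2pi {z. poly p z = 0}"
  shows "set (zeros_ccw p) = {z. poly p z = 0}"
    and "sorted_wrt (\<lambda>z w. Arg2pi z < Arg2pi w) (zeros_ccw p)"
  using sorted_key_list_of_set_inj_on[OF poly_roots_finite[OF assms(1)] assms(2)]
  by (simp_all add: zeros_ccw_def sorted_wrt_map)

text \<open>The \<open>k\<close>-th zero, counted from \<open>k = 1\<close>.\<close>

definition popuc_zero :: "(nat \<Rightarrow> complex) \<Rightarrow> complex \<Rightarrow> nat \<Rightarrow> nat \<Rightarrow> complex" where
  "popuc_zero \<alpha> \<beta> n k = zeros_ccw (popuc \<alpha> \<beta> n) ! (k - 1)"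

text \<open>\<open>f\<close> is a function of the positive integers; \<open>f 0\<close> is irrelevant. The expression
  \<open>shifted f k n\<close> is \<open>f (n - k \<surd>n)\<close> with the argument replaced by the closest integer. It is
  only used in limits, so that the small \<open>n\<close> with \<open>n - k \<surd>n < 1\<close> do not matter.\<close>

definition shifted :: "(nat \<Rightarrow> real) \<Rightarrow> nat \<Rightarrow> nat \<Rightarrow> real" where
  "shifted f k n = f (nat (round (real n - real k * sqrt (real n))))"

definition slow_decay :: "(nat \<Rightarrow> complex) \<Rightarrow> (nat \<Rightarrow> real) \<Rightarrow> bool" where
  "slow_decay \<alpha> f \<longleftrightarrow>
     (\<forall>n>0. f n \<le> 0) \<and>
     ((\<exists>b C. 0 < b \<and> b < 1 \<and> C > 0 \<and> (\<forall>n>0. f n = - C * real n powr (- b))) \<or>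
      filterlim (\<lambda>n. sqrt (real n) * (shifted f 1 n)\<^sup>2) at_top sequentially) \<and>
     (\<forall>n>0. f n < f (n + 1) \<and> f (n + 1) < 0) \<and>
     f \<longlonglongrightarrow> 0 \<and>
     (\<forall>k. (\<lambda>n. shifted f k n / f n) \<longlonglongrightarrow> 1) \<and>
     (\<lambda>n. \<alpha> n / of_real (f n)) \<longlonglongrightarrow> 1 \<and>
     (\<exists>m0>0. \<forall>m\<ge>m0. \<forall>n\<le>m. Re (\<alpha> n) \<le> f m)"

end

theory Submission
  imports Defs "HOL-Real_Asymp.Real_Asymp"
begin

text \<open>
  On the unit circle \<open>b\<^sub>n(z) = z \<Phi>\<^sub>n(z) / \<Phi>\<^sub>n\<^sup>*(z)\<close> has modulus one, and \<open>z\<close> is a zero of the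
  paraorthogonal polynomial of degree \<open>M\<close> iff \<open>b\<close> with index \<open>M - 1\<close> takes the value
  \<open>cnj \<beta>\<close> there. The proof follows a continuous argument of \<open>b\<^sub>n\<close>. Write \<open>z = cis x\<close> and
  \<open>b\<^sub>n(z) = cis (\<eta>\<^sub>n(x))\<close>. For real coefficients the Szego recursion becomes
  \<open>b\<^sub>n\<^sub>+\<^sub>1 = z (b\<^sub>n - \<alpha>\<^sub>n) / (1 - \<alpha>\<^sub>n b\<^sub>n)\<close>, so \<open>\<eta>\<^sub>n\<close> has an explicit recursion on the real line
  (\<open>prufer_phase\<close>): apply an increasing lift of a Blaschke factor, then add \<open>x\<close>. Hence
  \<open>\<eta>\<^sub>n\<close> is continuous and strictly increasing in \<open>x\<close>, it vanishes at \<open>0\<close> and equals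
  \<open>2 \<pi> (n + 1)\<close> at \<open>2 \<pi>\<close>. For \<open>\<beta> = cis \<xi>\<close> the \<open>k\<close>-th zero is therefore the point where
  \<open>\<eta>\<close> with index \<open>M - 1\<close> reaches \<open>2 \<pi> k - \<xi>\<close> (\<open>prufer_phase_Arg2pi_popuc_zero\<close>).

  The number \<open>2 \<bar>f M\<bar>\<close> is where the dynamics of the phase changes its type. The circle map with
  coefficient \<open>a < 0\<close> and rotation \<open>x\<close> has a fixed point iff \<open>sin (x / 2) \<le> \<bar>a\<bar>\<close>.

  \<^item> Take \<open>x = 2 \<bar>f M\<bar>\<close>, the edge of the gap around \<open>1\<close>. For large \<open>M\<close> slow decay includes the
    bound \<open>\<alpha>\<^sub>n \<le> f M\<close> for all \<open>n \<le> M\<close>, so \<open>\<bar>\<alpha>\<^sub>n\<bar> \<ge> \<bar>f M\<bar> \<ge> sin (x / 2)\<close>. All the maps have fixed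
    points, and the phase stays below \<open>\<pi> / 2 + x / 2\<close>
    (\<open>eventually_prufer_phase_le\<close>), which is less than every level \<open>2 \<pi> k - \<xi>\<close> as soon as
    \<open>\<bar>f M\<bar>\<close> is smaller than the distance from \<open>\<xi>\<close> to \<open>3 \<pi> / 2\<close>.

  \<^item> At \<open>x = 2 (1 + e) \<bar>f M\<bar>\<close> slow decay provides a window of indices ending at \<open>M\<close> in which
    \<open>\<bar>\<alpha>\<^sub>n\<bar>\<close> exceeds \<open>\<bar>f M\<bar>\<close> by at most a factor close to \<open>1\<close>, so each step of the window
    advances the phase by at least \<open>e \<bar>f M\<bar>\<close>. The length of the window times \<open>\<bar>f M\<bar>\<close>
    tends to infinity (\<open>slow_decay_window\<close>), so the phase exceeds any fixed bound
    (\<open>eventually_prufer_phase_ge\<close>).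

  By monotonicity every level between these two values is attained between these two points.
  The zeros approaching \<open>1\<close> from below reduce to the same statement, because the phase is
  symmetric under \<open>x \<mapsto> 2 \<pi> - x\<close>: this exchanges \<open>\<xi>\<close> with \<open>2 \<pi> - \<xi>\<close>, and the interval
  allowed for \<open>\<xi>\<close> is symmetric about \<open>\<pi>\<close>.
\<close>

section \<open>Lifting a Blaschke factor to the real line\<close>

text \<open>The lift, fixing \<open>0\<close>, of the circle map \<open>b \<mapsto> (b - a) / (1 - a b)\<close>. With
  \<open>w = 1 - a cis (- t)\<close> the image of \<open>cis t\<close> is \<open>cis t * w / cnj w\<close>, so the argument grows by
  twice that of \<open>w\<close>, and \<open>w\<close> lies in the right half-plane, where \<open>arctan\<close> computes it.\<close>

definition blaschke_phase :: "real \<Rightarrow> real \<Rightarrow> real" where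
  "blaschke_phase a t = t + 2 * arctan (a * sin t / (1 - a * cos t))"

lemma mult_cos_le_abs: "a * cos t \<le> \<bar>a\<bar>" for a t :: real
proof -
  have "a * cos t \<le> \<bar>a\<bar> * \<bar>cos t\<bar>"
    by (metis abs_ge_self abs_mult)
  also have "\<dots> \<le> \<bar>a\<bar> * 1"
    by (intro mult_left_mono) auto
  finally show ?thesis
    by simp
qed

lemma one_minus_mult_cos_pos:
  fixes a t :: real
  assumes "\<bar>a\<bar> < 1"
  shows "1 - a * cos t > 0"
  using mult_cos_le_abs[of a t] assms by simp

lemma cis_double_arctan:
  assumes "x > 0"
  shows "cis (2 * arctan (y / x)) * Complex x (- y) = Complex x y"
proof -
  define u where "u = arctan (y / x)"
  have c: "cos u > 0"
    using arctan_bounded[of "y / x"] by (auto simp: u_def intro: cos_gt_zero_pi)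
  have y: "y = x * (sin u / cos u)"
    using assms tan_arctan[of "y / x"] by (simp add: u_def tan_def field_simps)
  have 1: "Complex x y = complex_of_real (x / cos u) * cis u"
    and 2: "Complex x (- y) = complex_of_real (x / cos u) * cis (- u)"
    using c by (auto simp: complex_eq_iff y)
  show ?thesis
    unfolding 1 2 u_def[symmetric] by (simp add: cis_mult mult.left_commute)
qed

lemma cis_blaschke_phase:
  assumes "\<bar>a\<bar> < 1"
  shows "cis (blaschke_phase a t) * (1 - of_real a * cis t) = cis t - of_real a"
proof -
  have "1 - of_real a * cis t = Complex (1 - a * cos t) (- (a * sin t))"
    by (simp add: complex_eq_iff)
  then have "cis (blaschke_phase a t) * (1 - of_real a * cis t) =
      cis t * (cis (2 * arctan (a * sin t / (1 - a * cos t))) *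
        Complex (1 - a * cos t) (- (a * sin t)))"
    by (simp add: blaschke_phase_def flip: cis_mult)
  also have "\<dots> = cis t * Complex (1 - a * cos t) (a * sin t)"
    by (simp only: cis_double_arctan[OF one_minus_mult_cos_pos[OF assms]])
  also have "Complex (1 - a * cos t) (a * sin t) = 1 - of_real a * cis (- t)"
    by (simp add: complex_eq_iff)
  also have "cis t * \<dots> = cis t - of_real a"
    by (simp add: algebra_simps cis_mult)
  finally show ?thesis .
qed

text \<open>The derivative is the Poisson kernel of the disc at the point \<open>a\<close>.\<close>

lemma blaschke_phase_has_derivative:
  assumes "\<bar>a\<bar> < 1"
  shows "(blaschke_phase a has_real_derivative (1 - a\<^sup>2) / (1 - 2 * a * cos t + a\<^sup>2)) (at t)"
proof -
  let ?d = "1 - a * cos t"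
  have d: "?d > 0"
    by (rule one_minus_mult_cos_pos[OF assms])
  have q: "?d\<^sup>2 + (a * sin t)\<^sup>2 = 1 - 2 * a * cos t + a\<^sup>2"
    using sin_cos_squared_add[of t] by algebra
  have q0: "?d\<^sup>2 + (a * sin t)\<^sup>2 > 0"
    using d by (simp add: sum_power2_gt_zero_iff)
  have n: "a * cos t * ?d - a * sin t * (a * sin t) = a * cos t - a\<^sup>2"
    using sin_cos_squared_add[of t] by algebra
  have r: "1 + (a * sin t / ?d)\<^sup>2 = (?d\<^sup>2 + (a * sin t)\<^sup>2) / ?d\<^sup>2"
    using d by (simp add: field_simps)
  have "(blaschke_phase a has_real_derivative
      1 + 2 * (inverse (1 + (a * sin t / ?d)\<^sup>2) *
        ((a * cos t * ?d - a * sin t * (a * sin t)) / (?d * ?d)))) (at t)"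
    unfolding blaschke_phase_def[abs_def] using d by (auto intro!: derivative_eq_intros)
  also have "inverse (1 + (a * sin t / ?d)\<^sup>2) *
        ((a * cos t * ?d - a * sin t * (a * sin t)) / (?d * ?d)) =
      (a * cos t - a\<^sup>2) / (1 - 2 * a * cos t + a\<^sup>2)"
    unfolding r n unfolding q using d by (simp add: power2_eq_square)
  also have "1 + 2 * \<dots> = (1 - a\<^sup>2) / (1 - 2 * a * cos t + a\<^sup>2)"
    using q0 unfolding q by (simp add: field_simps)
  finally show ?thesis .
qed

lemma strict_mono_blaschke_phase:
  assumes "\<bar>a\<bar> < 1"
  shows "strict_mono (blaschke_phase a)"
proof (rule strict_monoI)
  fix s t :: real
  assume "s < t"
  then show "blaschke_phase a s < blaschke_phase a t"
  proof (rule DERIV_pos_imp_increasing)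
    fix x :: real
    have "1 - 2 * a * cos x + a\<^sup>2 = (1 - a * cos x)\<^sup>2 + (a * sin x)\<^sup>2"
      using sin_cos_squared_add[of x] by algebra
    then have "1 - 2 * a * cos x + a\<^sup>2 > 0"
      using one_minus_mult_cos_pos[OF assms, of x] by (simp add: sum_power2_gt_zero_iff)
    moreover have "1 - a\<^sup>2 > 0"
      using assms by (simp add: abs_square_less_1)
    ultimately show "\<exists>y. (blaschke_phase a has_real_derivative y) (at x) \<and> y > 0"
      using blaschke_phase_has_derivative[OF assms] by (metis divide_pos_pos)
  qed
qed

lemma isCont_blaschke_phase:
  assumes "\<bar>a\<bar> < 1"
  shows "isCont (blaschke_phase a) t"
  using blaschke_phase_has_derivative[OF assms] by (rule DERIV_isCont)

lemma blaschke_phase_0 [simp]: "blaschke_phase a 0 = 0"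
  by (simp add: blaschke_phase_def)

lemma blaschke_phase_minus: "blaschke_phase a (- t) = - blaschke_phase a t"
  by (simp add: blaschke_phase_def arctan_minus)

lemma blaschke_phase_add_2pi:
  "blaschke_phase a (t + 2 * pi * real n) = blaschke_phase a t + 2 * pi * real n"
proof -
  have "sin (t + 2 * pi * real n) = sin t" "cos (t + 2 * pi * real n) = cos t"
    using sin.plus_of_nat[of t n] cos.plus_of_nat[of t n] by (simp_all add: mult_ac)
  then show ?thesis
    by (simp add: blaschke_phase_def)
qed

text \<open>The argument of \<open>1 - a cis (- t)\<close> is at most \<open>arcsin \<bar>a\<bar>\<close> in modulus. The rational bound
  used here is cruder but agrees with it to first order in \<open>\<bar>a\<bar>\<close>, the order at which the
  constant \<open>2\<close> of the asymptotics is decided.\<close>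

lemma blaschke_phase_ge:
  assumes "\<bar>a\<bar> \<le> c" "c < 1"
  shows "blaschke_phase a t \<ge> t - 2 * (c / (1 - c))"
proof -
  have d: "1 - a * cos t \<ge> 1 - c"
    using mult_cos_le_abs[of a t] assms by simp
  have "\<bar>arctan (a * sin t / (1 - a * cos t))\<bar> \<le> \<bar>a * sin t / (1 - a * cos t)\<bar>"
    by (rule abs_arctan_le)
  also have "\<dots> = \<bar>a\<bar> * \<bar>sin t\<bar> / (1 - a * cos t)"
    using d assms by (simp add: abs_mult)
  also have "\<dots> \<le> c / (1 - c)"
  proof (rule frac_le)
    have "\<bar>a\<bar> * \<bar>sin t\<bar> \<le> c * 1"
      using assms by (intro mult_mono) auto
    then show "\<bar>a\<bar> * \<bar>sin t\<bar> \<le> c"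
      by simp
  qed (use d assms in auto)
  finally show ?thesis
    by (simp add: blaschke_phase_def)
qed

text \<open>With \<open>s = sin (x / 2)\<close> and \<open>c = cos (x / 2)\<close>, the point \<open>\<pi> / 2 + x / 2\<close> does not move
  forward iff \<open>s / c \<le> - a c / (1 + a s)\<close>. Clearing denominators and using \<open>s\<^sup>2 + c\<^sup>2 = 1\<close> turns
  this into \<open>s \<le> - a\<close>. The fixed points of the map satisfy
  \<open>sin (t - x / 2) = - s / a\<close> and so lie symmetrically about \<open>\<pi> / 2 + x / 2\<close>, which makes this
  barrier work for all coefficients at once.\<close>

lemma blaschke_phase_trap:
  assumes "\<bar>a\<bar> < 1" "0 \<le> x" "x < pi" "sin (x / 2) \<le> - a"
  shows "blaschke_phase a (pi / 2 + x / 2) + x \<le> pi / 2 + x / 2"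
proof -
  define s c where "s = sin (x / 2)" and "c = cos (x / 2)"
  have c: "c > 0"
    using assms by (auto simp: c_def intro!: cos_gt_zero_pi)
  have d: "1 + a * s > 0"
    using one_minus_mult_cos_pos[OF assms(1), of "pi / 2 + x / 2"] by (simp add: s_def cos_add)
  have sc: "s\<^sup>2 + c\<^sup>2 = 1"
    by (simp add: s_def c_def)
  have "s * (1 + a * s) \<le> - (a * c) * c"
  proof -
    have "- (a * c) * c - s * (1 + a * s) = - a - s"
      using sc by algebra
    then show ?thesis
      using assms(4) by (simp add: s_def)
  qed
  then have "s / c \<le> - (a * c) / (1 + a * s)"
    using c d by (simp add: field_simps)
  then have "arctan (s / c) \<le> - arctan (a * c / (1 + a * s))"
    by (metis arctan_le_iff arctan_minus minus_divide_left)
  moreover have "arctan (s / c) = x / 2"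
    using arctan_tan[of "x / 2"] assms by (simp add: s_def c_def tan_def)
  ultimately show ?thesis
    by (simp add: blaschke_phase_def sin_add cos_add s_def c_def)
qed

section \<open>The Pruefer phase\<close>

text \<open>The continuous argument of \<open>z \<Phi>\<^sub>n(z) / \<Phi>\<^sub>n\<^sup>*(z)\<close> at \<open>z = cis x\<close> that vanishes at
  \<open>x = 0\<close>; see \<open>opuc_prufer_phase\<close> below.\<close>

primrec prufer_phase :: "(nat \<Rightarrow> real) \<Rightarrow> nat \<Rightarrow> real \<Rightarrow> real" where
  "prufer_phase a 0 x = x"
| "prufer_phase a (Suc n) x = blaschke_phase (a n) (prufer_phase a n x) + x"

lemma strict_mono_prufer_phase:
  assumes "\<And>n. \<bar>a n\<bar> < 1"
  shows "strict_mono (prufer_phase a n)"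
proof (induction n)
  case 0
  show ?case
    by (simp add: strict_mono_def)
next
  case (Suc n)
  then show ?case
    using strict_mono_blaschke_phase[OF assms, of n]
    by (auto simp: strict_mono_def intro!: add_strict_mono)
qed

lemma isCont_prufer_phase:
  assumes "\<And>n. \<bar>a n\<bar> < 1"
  shows "isCont (prufer_phase a n) x"
proof (induction n)
  case (Suc n)
  have "isCont (\<lambda>x. blaschke_phase (a n) (prufer_phase a n x)) x"
    by (rule isCont_o2[OF Suc isCont_blaschke_phase[OF assms]])
  then show ?case
    by (auto intro: continuous_add)
qed simp

lemma prufer_phase_0 [simp]: "prufer_phase a n 0 = 0"
  by (induction n) auto

text \<open>Since the coefficients are real, \<open>b\<^sub>n\<close> commutes with complex conjugation.\<close>

lemma prufer_phase_reflect:
  "prufer_phase a n (2 * pi - x) = 2 * pi * real (Suc n) - prufer_phase a n x"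
proof (induction n)
  case (Suc n)
  have "blaschke_phase (a n) (2 * pi * real (Suc n) - prufer_phase a n x) =
      2 * pi * real (Suc n) - blaschke_phase (a n) (prufer_phase a n x)"
    using blaschke_phase_add_2pi[of "a n" "- prufer_phase a n x" "Suc n"]
    by (simp add: blaschke_phase_minus)
  then show ?case
    unfolding prufer_phase.simps Suc.IH by (simp add: algebra_simps)
qed simp

lemma prufer_phase_2pi: "prufer_phase a n (2 * pi) = 2 * pi * real (Suc n)"
  using prufer_phase_reflect[of a n 0] by simp

lemma prufer_phase_le:
  assumes "\<And>i. \<bar>a i\<bar> < 1" "\<And>i. i < n \<Longrightarrow> sin (x / 2) \<le> - a i" "0 \<le> x" "x < pi"
  shows "prufer_phase a n x \<le> pi / 2 + x / 2"
  using assms(2)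
proof (induction n)
  case (Suc n)
  have "prufer_phase a n x \<le> pi / 2 + x / 2"
    using Suc by simp
  then have "blaschke_phase (a n) (prufer_phase a n x) + x \<le>
      blaschke_phase (a n) (pi / 2 + x / 2) + x"
    using strict_mono_less_eq[OF strict_mono_blaschke_phase[OF assms(1)]] by simp
  also have "\<dots> \<le> pi / 2 + x / 2"
    using Suc.prems assms by (intro blaschke_phase_trap) auto
  finally show ?case
    by simp
qed (use assms in simp)

text \<open>The first \<open>m\<close> steps keep the phase nonnegative because \<open>0\<close> is fixed by every Blaschke
  lift; each of the next \<open>l\<close> steps rotates by \<open>x\<close> and loses at most what the coefficient bound
  permits.\<close>

lemma prufer_phase_ge:
  assumes "\<And>i. \<bar>a i\<bar> < 1" "\<And>i. m \<le> i \<Longrightarrow> i < m + l \<Longrightarrow> \<bar>a i\<bar> \<le> c" "c < 1" "0 \<le> x"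
  shows "prufer_phase a (m + l) x \<ge> real l * (x - 2 * (c / (1 - c)))"
  using assms(2)
proof (induction l)
  case 0
  have "prufer_phase a m 0 \<le> prufer_phase a m x"
    using assms(4) by (simp only: strict_mono_less_eq[OF strict_mono_prufer_phase[OF assms(1)]])
  then show ?case
    by simp
next
  case (Suc l)
  define y where "y = prufer_phase a (m + l) x"
  define d where "d = 2 * (c / (1 - c))"
  have IH: "real l * (x - d) \<le> y"
    unfolding y_def d_def by (rule Suc.IH) (simp add: Suc.prems)
  have "\<bar>a (m + l)\<bar> \<le> c"
    by (rule Suc.prems) auto
  then have step: "y - d \<le> blaschke_phase (a (m + l)) y"
    unfolding d_def by (rule blaschke_phase_ge[OF _ assms(3)])
  have "real (Suc l) * (x - d) = real l * (x - d) - d + x"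
    by (simp add: algebra_simps)
  also have "\<dots> \<le> blaschke_phase (a (m + l)) y + x"
    using IH step by linarith
  finally show ?case
    by (simp only: d_def y_def add_Suc_right prufer_phase.simps)
qed

section \<open>Zeros as levels of the Pruefer phase\<close>

lemma degree_szego_dual: "degree (szego_dual n p) \<le> n"
  unfolding szego_dual_def
  by (intro degree_sum_le) (auto intro: order_trans[OF degree_monom_le])

lemma degree_szego_step:
  assumes "degree p \<le> n"
  shows "degree ([:0, 1:] * p - smult c (szego_dual n p)) \<le> Suc n"
proof (rule degree_diff_le)
  show "degree ([:0, 1:] * p) \<le> Suc n"
    using assms by (simp add: degree_pCons_le le_trans)
  show "degree (smult c (szego_dual n p)) \<le> Suc n"
    using degree_szego_dual[of n p] degree_smult_le[of c "szego_dual n p"] by linarith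
qed

lemma degree_opuc: "degree (opuc \<alpha> n) \<le> n"
proof (induction n)
  case (Suc n)
  then show ?case
    unfolding opuc.simps by (rule degree_szego_step)
qed simp

text \<open>The identity is stated without a quotient, together with the nonvanishing of
  \<open>\<Phi>\<^sub>n\<^sup>*\<close> on the circle that makes the quotient meaningful. Both follow by induction from
  \<open>\<Phi>\<^sub>n\<^sub>+\<^sub>1 = (u - \<alpha>\<^sub>n) \<Phi>\<^sub>n\<^sup>*\<close> and \<open>\<Phi>\<^sub>n\<^sub>+\<^sub>1\<^sup>* = (1 - \<alpha>\<^sub>n u) \<Phi>\<^sub>n\<^sup>*\<close>, where \<open>u = b\<^sub>n(z)\<close>.\<close>

lemma opuc_prufer_phase:
  fixes a :: "nat \<Rightarrow> real"
  assumes "\<And>n. \<bar>a n\<bar> < 1"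
  defines "p \<equiv> \<lambda>n. opuc (\<lambda>n. of_real (a n)) n"
  shows "poly (szego_dual n (p n)) (cis x) \<noteq> 0 \<and>
    cis x * poly (p n) (cis x) = cis (prufer_phase a n x) * poly (szego_dual n (p n)) (cis x)"
proof (induction n)
  case 0
  show ?case
    by (simp add: p_def szego_dual_def)
next
  case (Suc n)
  define z where "z = cis x"
  define u where "u = cis (prufer_phase a n x)"
  define q where "q = poly (szego_dual n (p n)) z"
  have z: "z \<noteq> 0" "1 / cnj z = z" "z * cnj z = 1"
    by (auto simp: z_def cis_cnj cis_mult field_simps)
  have u: "u * cnj u = 1"
    by (auto simp: u_def cis_cnj cis_mult)
  have IH: "q \<noteq> 0" "z * poly (p n) z = u * q"
    using Suc by (auto simp: q_def u_def z_def)
  have dual: "poly (szego_dual m (p m)) z = z ^ m * cnj (poly (p m) z)" for m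
    using poly_szego_dual[OF degree_opuc z(1)] z(2) by (simp add: p_def)
  have step: "poly (p (Suc n)) z = (u - of_real (a n)) * q"
    using IH(2) by (simp add: p_def q_def algebra_simps)
  have pn: "z ^ n * cnj q = poly (p n) z"
    unfolding q_def dual using z(3)
    by (simp flip: mult.assoc power_mult_distrib)
  have "poly (szego_dual (Suc n) (p (Suc n))) z = (cnj u - of_real (a n)) * (z * (z ^ n * cnj q))"
    unfolding dual step by (simp add: algebra_simps)
  also have "\<dots> = (cnj u - of_real (a n)) * (u * q)"
    unfolding pn IH(2) ..
  also have "\<dots> = (1 - of_real (a n) * u) * q"
    using u by (simp add: algebra_simps)
  finally have dual': "poly (szego_dual (Suc n) (p (Suc n))) z = (1 - of_real (a n) * u) * q" .
  have "norm (of_real (a n) * u) < 1"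
    using assms(1)[of n] by (simp add: norm_mult u_def)
  then have nz: "1 - of_real (a n) * u \<noteq> 0"
    by (metis eq_iff_diff_eq_0 norm_one less_irrefl)
  have "cis (prufer_phase a (Suc n) x) * (1 - of_real (a n) * u) = z * (u - of_real (a n))"
    using cis_blaschke_phase[OF assms(1), of n "prufer_phase a n x"]
    by (simp add: u_def z_def mult_ac flip: cis_mult)
  then show ?case
    using nz IH(1) unfolding z_def[symmetric] dual' step by (simp flip: mult.assoc)
qed

lemma poly_popuc_cis_eq_0_iff:
  fixes a :: "nat \<Rightarrow> real"
  assumes "\<And>n. \<bar>a n\<bar> < 1"
  shows "poly (popuc (\<lambda>n. of_real (a n)) (cis \<xi>) (Suc n)) (cis x) = 0 \<longleftrightarrow>
    cis (prufer_phase a n x) = cis (- \<xi>)"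
  using opuc_prufer_phase[OF assms, where n = n and x = x] by (simp add: popuc_def cis_cnj)

lemma Arg2pi_cis_eq:
  assumes "0 \<le> x" "x < 2 * pi"
  shows "Arg2pi (cis x) = x"
  by (rule Arg2pi_unique[of 1]) (use assms in \<open>auto simp: cis_conv_exp\<close>)

text \<open>The phase runs monotonically from \<open>0\<close> to \<open>2 \<pi> (n + 1)\<close> on \<open>[0, 2 \<pi>]\<close> and so meets each of
  the \<open>n + 1\<close> levels congruent to \<open>- \<xi>\<close> exactly once. These points give \<open>n + 1\<close> zeros, which by
  the degree bound are all of them, already listed in the order of their arguments.\<close>

lemma prufer_phase_Arg2pi_popuc_zero:
  fixes a :: "nat \<Rightarrow> real"
  assumes a: "\<And>n. \<bar>a n\<bar> < 1" and \<xi>: "0 < \<xi>" "\<xi> < 2 * pi" and j: "1 \<le> j" "j \<le> Suc n"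
  shows "prufer_phase a n (Arg2pi (popuc_zero (\<lambda>n. of_real (a n)) (cis \<xi>) (Suc n) j)) =
      2 * pi * real j - \<xi>"
proof -
  define P where "P = popuc (\<lambda>n. of_real (a n)) (cis \<xi>) (Suc n)"
  have mono: "strict_mono (prufer_phase a n)"
    by (rule strict_mono_prufer_phase[OF a])
  have "\<exists>x. 0 < x \<and> x < 2 * pi \<and> prufer_phase a n x = 2 * pi * real (Suc i) - \<xi>"
    if "i < Suc n" for i
  proof -
    have i: "2 * pi * real (Suc i) \<le> 2 * pi * real (Suc n)"
      using that by (intro mult_left_mono) auto
    have "2 * pi * real (Suc i) \<ge> 2 * pi * 1"
      by (intro mult_left_mono) auto
    then have i': "2 * pi * real (Suc i) - \<xi> > 0"
      using \<xi> by linarith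
    have "\<exists>x. 0 \<le> x \<and> x \<le> 2 * pi \<and> prufer_phase a n x = 2 * pi * real (Suc i) - \<xi>"
    proof (rule IVT)
      show "prufer_phase a n 0 \<le> 2 * pi * real (Suc i) - \<xi>"
        using i' by simp
      show "2 * pi * real (Suc i) - \<xi> \<le> prufer_phase a n (2 * pi)"
        unfolding prufer_phase_2pi using i \<xi> by linarith
    qed (simp_all add: isCont_prufer_phase[OF a])
    then obtain x where x: "0 \<le> x" "x \<le> 2 * pi"
      "prufer_phase a n x = 2 * pi * real (Suc i) - \<xi>"
      by blast
    have "x \<noteq> 0"
      using x(3) i' prufer_phase_0[of a n] by (metis less_irrefl)
    moreover have "x \<noteq> 2 * pi"
    proof
      assume "x = 2 * pi"
      then have "2 * pi * real (Suc n) = 2 * pi * real (Suc i) - \<xi>"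
        using x(3) by (simp only: prufer_phase_2pi)
      then show False
        using i \<xi>(1) by linarith
    qed
    ultimately show ?thesis
      using x by (intro exI[of _ x]) auto
  qed
  then obtain x where x: "\<And>i. i < Suc n \<Longrightarrow> 0 < x i" "\<And>i. i < Suc n \<Longrightarrow> x i < 2 * pi"
    "\<And>i. i < Suc n \<Longrightarrow> prufer_phase a n (x i) = 2 * pi * real (Suc i) - \<xi>"
    by metis
  have less: "x i < x i'" if "i < i'" "i' < Suc n" for i i'
    using that x(3)[of i] x(3)[of i'] strict_mono_less[OF mono, of "x i" "x i'"] by simp
  have Arg: "Arg2pi (cis (x i)) = x i" if "i < Suc n" for i
    using x[OF that] by (simp add: Arg2pi_cis_eq)
  have inj: "inj_on (\<lambda>i. cis (x i)) {..<Suc n}"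
    using less Arg by (intro inj_onI) (metis lessThan_iff linorder_neqE_nat less_irrefl)
  have root: "poly P (cis (x i)) = 0" if "i < Suc n" for i
    unfolding P_def poly_popuc_cis_eq_0_iff[OF a] x(3)[OF that]
    using cis_multiple_2pi[of "real (Suc i)"] cis_mult[of "2 * pi * real (Suc i)" "- \<xi>"]
    by (simp del: of_nat_Suc)
  \<comment> \<open>At \<open>z = 1\<close> the phase is \<open>0\<close>, which is not congruent to \<open>- \<xi>\<close>.\<close>
  have "poly P (cis 0) \<noteq> 0"
  proof
    assume "poly P (cis 0) = 0"
    then have "cis \<xi> = 1"
      unfolding P_def poly_popuc_cis_eq_0_iff[OF a] by (simp flip: cis_cnj)
    then have "Arg2pi (cis \<xi>) = Arg2pi 1"
      by simp
    then show False
      using \<xi> Arg2pi_cis_eq[of \<xi>] Arg2pi_cis_eq[of 0] by simp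
  qed
  then have P0: "P \<noteq> 0"
    by auto
  have "degree P \<le> Suc n"
    using degree_szego_step[OF degree_opuc, of _ n] by (simp add: P_def popuc_def)
  then have "card {z. poly P z = 0} \<le> Suc n"
    using card_poly_roots_bound[OF P0] by simp
  then have roots: "{z. poly P z = 0} = (\<lambda>i. cis (x i)) ` {..<Suc n}"
    using root poly_roots_finite[OF P0] card_image[OF inj]
    by (intro card_seteq[symmetric]) auto
  have inj': "inj_on Arg2pi {z. poly P z = 0}"
    unfolding roots using Arg by (intro inj_onI) auto
  have "map Arg2pi (zeros_ccw P) = map x [0..<Suc n]"
  proof (rule strict_sorted_equal)
    show "sorted_wrt (<) (map Arg2pi (zeros_ccw P))"
      using zeros_ccw(2)[OF P0 inj'] by (simp add: sorted_wrt_map)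
    show "sorted_wrt (<) (map x [0..<Suc n])"
      using less unfolding sorted_wrt_map
      by (auto simp: sorted_wrt_iff_nth_less simp del: upt_Suc)
    show "set (map Arg2pi (zeros_ccw P)) = set (map x [0..<Suc n])"
      unfolding set_map zeros_ccw(1)[OF P0 inj'] roots image_image set_upt atLeast0LessThan
      by (rule image_cong) (use Arg in simp_all)
  qed
  note eq = this
  have len: "length (zeros_ccw P) = Suc n"
    using arg_cong[OF eq, of length] by simp
  have "Arg2pi (zeros_ccw P ! (j - 1)) = map Arg2pi (zeros_ccw P) ! (j - 1)"
    using j len by simp
  also have "\<dots> = x (j - 1)"
    unfolding eq using j by (simp del: upt_Suc)
  finally have "Arg2pi (zeros_ccw P ! (j - 1)) = x (j - 1)" .
  moreover have "popuc_zero (\<lambda>n. of_real (a n)) (cis \<xi>) (Suc n) j = zeros_ccw P ! (j - 1)"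
    by (simp add: popuc_zero_def P_def)
  ultimately show ?thesis
    using x(3)[of "j - 1"] j by auto
qed

section \<open>Windows on which a slowly decaying function is nearly constant\<close>

lemma slow_decay_neg:
  assumes "slow_decay \<alpha> f" "n > 0"
  shows "f n < 0"
proof -
  have "\<forall>n>0. f n < f (n + 1) \<and> f (n + 1) < 0"
    using assms(1) unfolding slow_decay_def by (elim conjE)
  then have "f n < f (n + 1)" "f (n + 1) < 0"
    using assms(2) by auto
  then show ?thesis
    by (rule less_trans)
qed

lemma slow_decay_abs_antimono:
  assumes "slow_decay \<alpha> f" "0 < m" "m \<le> i"
  shows "\<bar>f i\<bar> \<le> \<bar>f m\<bar>"
proof -
  have "\<forall>n>0. f n < f (n + 1) \<and> f (n + 1) < 0"
    using assms(1) unfolding slow_decay_def by (elim conjE)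
  then have incr: "f n < f (n + 1)" if "n > 0" for n
    using that by blast
  from \<open>m \<le> i\<close> have "f m \<le> f i"
  proof (induction i rule: dec_induct)
    case (step n)
    then show ?case
      using incr[of n] assms(2) by simp
  qed simp
  then show ?thesis
    using slow_decay_neg[OF assms(1), of m] slow_decay_neg[OF assms(1), of i] assms(2,3) by simp
qed

text \<open>A window of length about \<open>n / q\<close>: over it a power law varies only by a factor close to \<open>1\<close>,
  and \<open>n * n powr (- b)\<close> tends to infinity because \<open>b < 1\<close>. A window of length
  \<open>sqrt n\<close> would be too short for \<open>b \<ge> 1 / 2\<close>.\<close>

lemma power_law_window:
  fixes b C e :: real
  assumes b: "0 < b" "b < 1" and C: "C > 0" and e: "e > 0"
    and f: "\<And>n. n > 0 \<Longrightarrow> f n = - C * real n powr (- b)"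
  shows "\<exists>m :: nat \<Rightarrow> nat. filterlim m at_top sequentially \<and> (\<forall>\<^sub>F n in sequentially. m n \<le> n) \<and>
    (\<forall>\<^sub>F n in sequentially. \<bar>f (m n)\<bar> \<le> (1 + e) * \<bar>f n\<bar>) \<and>
    filterlim (\<lambda>n. real (n - m n) * \<bar>f n\<bar>) at_top sequentially"
proof -
  \<comment> \<open>Chosen so that \<open>q / (q - 1) \<le> 1 + e\<close>.\<close>
  define q where "q = nat \<lceil>1 / e\<rceil> + 2"
  define m where "m n = n - n div q" for n
  have q: "q \<ge> 2" "real q - 1 \<ge> 1 / e"
    unfolding q_def by (auto, linarith)
  have m_ge: "real n \<le> (1 + e) * real (m n)" for n
  proof -
    have "real (n div q) \<le> real n / real q"
      by (rule of_nat_div_le_of_nat)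
    then have "real (m n) \<ge> real n - real n / real q"
      by (simp add: m_def of_nat_diff)
    moreover have "real n \<le> (1 + e) * (real n - real n / real q)"
    proof -
      have "1 \<le> e * (real q - 1)"
        using q(2) e by (simp add: field_simps)
      then have "real n * real q \<le> real n * ((1 + e) * (real q - 1))"
        by (intro mult_left_mono) (auto simp: algebra_simps)
      then show ?thesis
        using q(1) by (simp add: field_simps)
    qed
    ultimately show ?thesis
      using e by (meson add_pos_pos less_eq_real_def mult_left_mono order_trans zero_less_one)
  qed
  have lim_m: "filterlim m at_top sequentially"
    unfolding filterlim_at_top
  proof
    fix Z :: nat
    show "\<forall>\<^sub>F n in sequentially. Z \<le> m n"
      using eventually_ge_at_top[of "nat \<lceil>(1 + e) * real Z\<rceil>"]
    proof eventually_elim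
      case (elim n)
      then have "(1 + e) * real Z \<le> (1 + e) * real (m n)"
        using m_ge[of n] by linarith
      then show ?case
        using e by simp
    qed
  qed
  have m_pos: "\<forall>\<^sub>F n in sequentially. m n > 0"
    using filterlim_at_top[THEN iffD1, OF lim_m, rule_format, of 1]
    by (rule eventually_mono) simp
  have ratio: "\<forall>\<^sub>F n in sequentially. \<bar>f (m n)\<bar> \<le> (1 + e) * \<bar>f n\<bar>"
    using eventually_gt_at_top[of 0] m_pos
  proof eventually_elim
    case (elim n)
    \<comment> \<open>The base is at least \<open>1\<close>, so the exponent \<open>b < 1\<close> may be raised to \<open>1\<close>.\<close>
    have "(real n / real (m n)) powr b \<le> (real n / real (m n)) powr 1"
      using elim b by (intro powr_mono) (auto simp: m_def)
    also have "\<dots> \<le> 1 + e"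
      using m_ge[of n] elim by (simp add: field_simps)
    finally have "real n powr b / real (m n) powr b \<le> 1 + e"
      by (simp add: powr_divide)
    then have "real (m n) powr (- b) \<le> (1 + e) * real n powr (- b)"
      using elim by (simp add: powr_minus field_simps)
    then have "C * real (m n) powr (- b) \<le> C * ((1 + e) * real n powr (- b))"
      using C by (intro mult_left_mono) auto
    then show ?case
      using elim C by (simp add: f abs_mult mult_ac)
  qed
  have "filterlim (\<lambda>n. (real n / real q - 1) * (C * real n powr (- b))) at_top sequentially"
    using b C q(1) by real_asymp
  then have "filterlim (\<lambda>n. real (n - m n) * \<bar>f n\<bar>) at_top sequentially"
  proof (rule filterlim_at_top_mono)
    show "\<forall>\<^sub>F n in sequentially. (real n / real q - 1) * (C * real n powr (- b)) \<le>
        real (n - m n) * \<bar>f n\<bar>"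
      using eventually_gt_at_top[of 0]
    proof eventually_elim
      case (elim n)
      have "n - m n = n div q"
        by (simp add: m_def)
      moreover have "real n / real q - 1 \<le> real (n div q)"
        using floor_divide_of_nat_eq[of n q, where ?'a = real] by linarith
      ultimately show ?case
        using elim C by (auto simp: f abs_mult intro!: mult_right_mono)
    qed
  qed
  then show ?thesis
    using lim_m ratio by (intro exI[of _ m]) (auto simp: m_def)
qed

text \<open>The window of length about \<open>sqrt n\<close> on which \<open>shifted f 1\<close> is built. Its length times
  \<open>\<bar>f n\<bar>\<close> tends to infinity because \<open>sqrt n * (f (n - sqrt n))\<^sup>2\<close> does, and
  \<open>(f (n - sqrt n))\<^sup>2 \<le> \<bar>f (n - sqrt n)\<bar>\<close> once \<open>f\<close> is small.\<close>

lemma sqrt_window: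
  fixes f :: "nat \<Rightarrow> real"
  assumes big: "filterlim (\<lambda>n. sqrt (real n) * (shifted f 1 n)\<^sup>2) at_top sequentially"
    and ratio: "(\<lambda>n. shifted f 1 n / f n) \<longlonglongrightarrow> 1"
    and neg: "\<And>n. n > 0 \<Longrightarrow> f n < 0" and lim: "f \<longlonglongrightarrow> 0" and e: "e > 0"
  shows "\<exists>m :: nat \<Rightarrow> nat. filterlim m at_top sequentially \<and> (\<forall>\<^sub>F n in sequentially. m n \<le> n) \<and>
    (\<forall>\<^sub>F n in sequentially. \<bar>f (m n)\<bar> \<le> (1 + e) * \<bar>f n\<bar>) \<and>
    filterlim (\<lambda>n. real (n - m n) * \<bar>f n\<bar>) at_top sequentially"
proof -
  define m where "m n = nat (round (real n - sqrt (real n)))" for n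
  have shifted: "shifted f 1 n = f (m n)" for n
    by (simp add: shifted_def m_def)
  have m_le: "real (m n) \<le> real n - sqrt (real n) + 1/2" if "n \<ge> 1" for n
  proof -
    have "sqrt (real n) \<le> sqrt (real n * real n)"
      using that by (intro real_sqrt_le_mono) auto
    then have "real n - sqrt (real n) \<ge> 0"
      by simp
    then have "round (real n - sqrt (real n)) \<ge> 0"
      using round_mono[of 0] by fastforce
    then have "real (m n) = of_int (round (real n - sqrt (real n)))"
      by (simp add: m_def)
    then show ?thesis
      using of_int_round_le[of "real n - sqrt (real n)"] by simp
  qed
  have m_ge: "real n - sqrt (real n) - 1/2 \<le> real (m n)" for n
    using of_int_round_ge[of "real n - sqrt (real n)"] unfolding m_def by linarith
  have "filterlim (\<lambda>n. real n - sqrt (real n) - 1/2) at_top sequentially"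
    by real_asymp
  then have "filterlim (\<lambda>n. real (m n)) at_top sequentially"
    by (rule filterlim_at_top_mono) (simp add: m_ge)
  then have lim_m: "filterlim m at_top sequentially"
    by (simp add: filterlim_sequentially_iff_filterlim_real)
  have m_pos: "\<forall>\<^sub>F n in sequentially. m n > 0"
    using filterlim_at_top[THEN iffD1, OF lim_m, rule_format, of 1]
    by (rule eventually_mono) simp
  have "\<forall>\<^sub>F n in sequentially. shifted f 1 n / f n < 1 + e"
    using order_tendstoD(2)[OF ratio] e by simp
  then have ratio': "\<forall>\<^sub>F n in sequentially. \<bar>f (m n)\<bar> \<le> (1 + e) * \<bar>f n\<bar>"
    using eventually_gt_at_top[of 0] m_pos
  proof eventually_elim
    case (elim n)
    then show ?case
      using neg[of n] neg[of "m n"] unfolding shifted by (simp add: field_simps)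
  qed
  have small: "\<forall>\<^sub>F n in sequentially. f (m n) > - 1"
    using order_tendstoD(1)[OF filterlim_compose[OF lim lim_m], of "-1"] by simp
  have "filterlim (\<lambda>n. (1 / (2 * (1 + e))) * (sqrt (real n) * (shifted f 1 n)\<^sup>2)) at_top sequentially"
    using big e by (intro filterlim_tendsto_pos_mult_at_top[OF tendsto_const]) auto
  then have "filterlim (\<lambda>n. real (n - m n) * \<bar>f n\<bar>) at_top sequentially"
  proof (rule filterlim_at_top_mono)
    show "\<forall>\<^sub>F n in sequentially. (1 / (2 * (1 + e))) * (sqrt (real n) * (shifted f 1 n)\<^sup>2) \<le>
        real (n - m n) * \<bar>f n\<bar>"
      using eventually_ge_at_top[of 1] small ratio'
        m_pos
    proof eventually_elim
      case (elim n)
      have s: "sqrt (real n) \<ge> 1"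
        using elim by simp
      have le: "real (m n) \<le> real n - sqrt (real n) + 1/2"
        using m_le elim by simp
      then have "m n \<le> n"
        using s by linarith
      then have "real (n - m n) = real n - real (m n)"
        by (rule of_nat_diff)
      then have l: "real (n - m n) \<ge> sqrt (real n) / 2"
        using le s by linarith
      have "(shifted f 1 n)\<^sup>2 = \<bar>f (m n)\<bar> * \<bar>f (m n)\<bar>"
        unfolding shifted by (simp add: power2_eq_square)
      also have "\<dots> \<le> 1 * \<bar>f (m n)\<bar>"
        using elim neg[of "m n"] by (intro mult_right_mono) auto
      finally have "(shifted f 1 n)\<^sup>2 \<le> (1 + e) * \<bar>f n\<bar>"
        using elim by linarith
      then have "(shifted f 1 n)\<^sup>2 / (1 + e) \<le> \<bar>f n\<bar>"
        using e by (simp add: field_simps)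
      then have "(sqrt (real n) / 2) * ((shifted f 1 n)\<^sup>2 / (1 + e)) \<le> real (n - m n) * \<bar>f n\<bar>"
        using l e by (intro mult_mono) auto
      then show ?case
        by simp
    qed
  qed
  moreover have "\<forall>\<^sub>F n in sequentially. m n \<le> n"
    using eventually_ge_at_top[of 1]
  proof eventually_elim
    case (elim n)
    then have "sqrt (real n) \<ge> 1"
      by simp
    then show ?case
      using m_le[of n] elim by linarith
  qed
  ultimately show ?thesis
    using lim_m ratio' by blast
qed

lemma slow_decay_window:
  assumes "slow_decay \<alpha> f" "e > 0"
  obtains m :: "nat \<Rightarrow> nat" where "filterlim m at_top sequentially"
    "\<forall>\<^sub>F n in sequentially. m n \<le> n"
    "\<forall>\<^sub>F n in sequentially. \<bar>f (m n)\<bar> \<le> (1 + e) * \<bar>f n\<bar>"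
    "filterlim (\<lambda>n. real (n - m n) * \<bar>f n\<bar>) at_top sequentially"
proof -
  have neg: "f n < 0" if "n > 0" for n
    using slow_decay_neg[OF assms(1) that] .
  have lim: "f \<longlonglongrightarrow> 0" and ratio: "(\<lambda>n. shifted f 1 n / f n) \<longlonglongrightarrow> 1"
    using assms(1) unfolding slow_decay_def by blast+
  from assms(1) consider (power) b C where "0 < b" "b < 1" "C > 0"
      "\<And>n. n > 0 \<Longrightarrow> f n = - C * real n powr (- b)"
    | (sqrt) "filterlim (\<lambda>n. sqrt (real n) * (shifted f 1 n)\<^sup>2) at_top sequentially"
    unfolding slow_decay_def by blast
  then show thesis
  proof cases
    case power
    from power_law_window[OF power(1-3) assms(2) power(4)] that show thesis
      by blast
  next
    case sqrt
    from sqrt_window[OF sqrt ratio neg lim assms(2)] that show thesis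
      by blast
  qed
qed

section \<open>The phase at the edge of the gap\<close>

text \<open>Just outside the gap the phase completes any number of turns. Three errors have to be
  absorbed into \<open>1 + e / 2\<close>, each of them a factor \<open>1 + d\<close>: the quotient of \<open>\<bar>\<alpha>\<^sub>n\<bar>\<close> and \<open>\<bar>f n\<bar>\<close>, the
  variation of \<open>f\<close> over the window, and the quotient of \<open>c / (1 - c)\<close> and \<open>c\<close> for the resulting
  bound \<open>c\<close> on the coefficients.\<close>

lemma eventually_prufer_phase_ge:
  fixes a :: "nat \<Rightarrow> real"
  assumes a: "\<And>n. \<bar>a n\<bar> < 1" and decay: "slow_decay (\<lambda>n. of_real (a n)) f"
    and e: "0 < e" "e \<le> 1"
  shows "\<forall>\<^sub>F M in sequentially. K \<le> prufer_phase a (M - 1) (2 * (1 + e) * \<bar>f M\<bar>)"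
proof -
  define d where "d = e / 8"
  have d: "d > 0" "(1 + d) ^ 3 \<le> 1 + e / 2"
  proof -
    have d': "0 \<le> d" "d \<le> 1" "d \<le> 1 / 8"
      using e by (auto simp: d_def)
    have "(1 + d) ^ 3 = 1 + 3 * d + 3 * (d * d) + d * (d * d)"
      by (simp add: power3_eq_cube algebra_simps)
    moreover have "d * d \<le> d * (1 / 8)"
      using d' by (intro mult_left_mono) auto
    moreover have "d * (d * d) \<le> 1 * (d * d)"
      using d' by (intro mult_right_mono) auto
    ultimately have "(1 + d) ^ 3 \<le> 1 + 4 * d"
      using d' by linarith
    then show "(1 + d) ^ 3 \<le> 1 + e / 2"
      by (simp add: d_def)
  qed (use e in \<open>simp add: d_def\<close>)
  obtain m where m: "filterlim m at_top sequentially"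
    "\<forall>\<^sub>F n in sequentially. m n \<le> n"
    "\<forall>\<^sub>F n in sequentially. \<bar>f (m n)\<bar> \<le> (1 + d) * \<bar>f n\<bar>"
    "filterlim (\<lambda>n. real (n - m n) * \<bar>f n\<bar>) at_top sequentially"
    by (rule slow_decay_window[OF decay d(1)])
  have neg: "f n < 0" if "n > 0" for n
    using slow_decay_neg[OF decay that] .
  have lim: "f \<longlonglongrightarrow> 0" and lim_a: "(\<lambda>n. of_real (a n) / of_real (f n) :: complex) \<longlonglongrightarrow> 1"
    using decay unfolding slow_decay_def by blast+
  have "(\<lambda>n. \<bar>a n\<bar> / \<bar>f n\<bar>) \<longlonglongrightarrow> 1"
    using tendsto_norm[OF lim_a] by (simp add: norm_divide)
  then have "\<forall>\<^sub>F n in sequentially. \<bar>a n\<bar> / \<bar>f n\<bar> < 1 + d"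
    using order_tendstoD(2) d(1) by fastforce
  then obtain n0 where n0: "\<And>n. n \<ge> n0 \<Longrightarrow> \<bar>a n\<bar> / \<bar>f n\<bar> < 1 + d"
    unfolding eventually_sequentially by blast
  have m_large: "\<forall>\<^sub>F n in sequentially. m n \<ge> max n0 1"
    using m(1) unfolding filterlim_at_top by blast
  have "(\<lambda>n. (1 + d)\<^sup>2 * \<bar>f n\<bar>) \<longlonglongrightarrow> (1 + d)\<^sup>2 * \<bar>0\<bar>"
    by (intro tendsto_intros lim)
  then have small: "\<forall>\<^sub>F n in sequentially. (1 + d)\<^sup>2 * \<bar>f n\<bar> < d / (1 + d)"
    by (rule order_tendstoD(2)) (use d(1) in simp)
  have f1: "\<forall>\<^sub>F n in sequentially. f n > - 1"
    using order_tendstoD(1)[OF lim, of "-1"] by simp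
  have long: "\<forall>\<^sub>F n in sequentially. real (n - m n) * \<bar>f n\<bar> \<ge> \<bar>K\<bar> / e + 1"
    using m(4) unfolding filterlim_at_top by blast
  show ?thesis
    using m(2,3) m_large small long eventually_gt_at_top[of 0] f1
  proof eventually_elim
    case (elim M)
    define c where "c = (1 + d)\<^sup>2 * \<bar>f M\<bar>"
    define l where "l = M - 1 - m M"
    have "m M \<noteq> M"
    proof
      assume "m M = M"
      then have "\<bar>K\<bar> / e + 1 \<le> 0"
        using elim(5) by simp
      moreover have "\<bar>K\<bar> / e \<ge> 0"
        using e by simp
      ultimately show False
        by linarith
    qed
    then have l: "M - 1 = m M + l" "real (M - m M) = real l + 1"
      using elim by (auto simp: l_def of_nat_diff)
    have c: "0 \<le> c" "c < d / (1 + d)"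
      using elim by (auto simp: c_def)
    have "d / (1 + d) < 1"
      using d by simp
    then have c1: "c < 1"
      using c by linarith
    have bound: "\<bar>a i\<bar> \<le> c" if "m M \<le> i" for i
    proof -
      have "\<bar>a i\<bar> \<le> (1 + d) * \<bar>f i\<bar>"
        using n0[of i] neg[of i] that elim(3) by (simp add: field_simps)
      also have "\<dots> \<le> (1 + d) * \<bar>f (m M)\<bar>"
        using slow_decay_abs_antimono[OF decay, of "m M" i] that elim(3) d
        by (intro mult_left_mono) auto
      also have "\<dots> \<le> (1 + d) * ((1 + d) * \<bar>f M\<bar>)"
        using elim(2) d by (intro mult_left_mono) auto
      finally show ?thesis
        by (simp add: c_def power2_eq_square)
    qed
    have "c * (1 + d) < d"
      using c(2) d by (simp add: field_simps)
    then have "1 \<le> (1 + d) * (1 - c)"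
      by (simp add: algebra_simps)
    then have "c * 1 \<le> c * ((1 + d) * (1 - c))"
      using c(1) by (rule mult_left_mono)
    then have "c / (1 - c) \<le> c * (1 + d)"
      using c1 by (simp add: field_simps)
    also have "\<dots> = (1 + d) ^ 3 * \<bar>f M\<bar>"
      by (simp add: c_def power2_eq_square power3_eq_cube)
    also have "\<dots> \<le> (1 + e / 2) * \<bar>f M\<bar>"
      using d by (intro mult_right_mono) auto
    finally have "2 * (c / (1 - c)) \<le> 2 * ((1 + e / 2) * \<bar>f M\<bar>)"
      by (rule mult_left_mono) simp
    also have "\<dots> = 2 * (1 + e) * \<bar>f M\<bar> - e * \<bar>f M\<bar>"
      by (simp add: algebra_simps)
    finally have gain: "e * \<bar>f M\<bar> \<le> 2 * (1 + e) * \<bar>f M\<bar> - 2 * (c / (1 - c))"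
      by simp
    have "\<bar>K\<bar> / e \<le> real l * \<bar>f M\<bar>"
      using elim(5,7) neg[of M] elim(6) unfolding l(2) by (simp add: algebra_simps)
    then have "K \<le> real l * (e * \<bar>f M\<bar>)"
      using e by (simp add: field_simps)
    also have "\<dots> \<le> real l * (2 * (1 + e) * \<bar>f M\<bar> - 2 * (c / (1 - c)))"
      by (intro mult_left_mono gain) simp
    also have "\<dots> \<le> prufer_phase a (M - 1) (2 * (1 + e) * \<bar>f M\<bar>)"
      unfolding l(1) using e by (intro prufer_phase_ge[OF a _ c1]) (auto intro: bound)
    finally show ?case .
  qed
qed

text \<open>At the edge all coefficients up to index \<open>M\<close> are at least \<open>\<bar>f M\<bar>\<close> in modulus, so no map of
  the recursion carries the phase past the barrier of \<open>blaschke_phase_trap\<close>.\<close>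

lemma eventually_prufer_phase_le:
  fixes a :: "nat \<Rightarrow> real"
  assumes a: "\<And>n. \<bar>a n\<bar> < 1" and decay: "slow_decay (\<lambda>n. of_real (a n)) f"
  shows "\<forall>\<^sub>F M in sequentially. prufer_phase a (M - 1) (2 * \<bar>f M\<bar>) \<le> pi / 2 + \<bar>f M\<bar>"
proof -
  obtain m0 where m0: "\<And>m n. m \<ge> m0 \<Longrightarrow> n \<le> m \<Longrightarrow> a n \<le> f m"
  proof -
    have "\<exists>m0>0. \<forall>m\<ge>m0. \<forall>n\<le>m. Re (of_real (a n)) \<le> f m"
      using decay unfolding slow_decay_def by blast
    then show thesis
      using that by auto
  qed
  have neg: "f n < 0" if "n > 0" for n
    using slow_decay_neg[OF decay that] .
  have "f \<longlonglongrightarrow> 0"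
    using decay unfolding slow_decay_def by blast
  then have "\<forall>\<^sub>F M in sequentially. f M > - 1"
    using order_tendstoD(1)[of f 0 _ "-1"] by simp
  then show ?thesis
    using eventually_ge_at_top[of m0] eventually_gt_at_top[of 0]
  proof eventually_elim
    case (elim M)
    have "sin \<bar>f M\<bar> \<le> - a i" if "i < M - 1" for i
    proof -
      have "sin \<bar>f M\<bar> \<le> \<bar>f M\<bar>"
        by (rule sin_x_le_x) simp
      also have "\<dots> \<le> - a i"
        using m0[of M i] neg[of M] elim that by simp
      finally show ?thesis .
    qed
    moreover have "2 * \<bar>f M\<bar> < pi"
      using elim neg[of M] pi_gt3 by simp
    ultimately show ?case
      using prufer_phase_le[OF a, of "M - 1" "2 * \<bar>f M\<bar>"] by simp
  qed
qed

lemma eventually_prufer_phase_levels_near: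
  fixes a :: "nat \<Rightarrow> real"
  assumes a: "\<And>n. \<bar>a n\<bar> < 1" and decay: "slow_decay (\<lambda>n. of_real (a n)) f"
    and eps: "eps > 0" and \<delta>: "\<delta> > 0"
  shows "\<forall>\<^sub>F M in sequentially. \<forall>x. prufer_phase a (M - 1) x \<in> {pi / 2 + eps..K} \<longrightarrow>
    \<bar>x / (2 * \<bar>f M\<bar>) - 1\<bar> < \<delta>"
proof -
  define e where "e = min 1 (\<delta> / 2)"
  have e: "0 < e" "e \<le> 1" "e < \<delta>"
    using \<delta> by (auto simp: e_def)
  have neg: "f n < 0" if "n > 0" for n
    using slow_decay_neg[OF decay that] .
  have "f \<longlonglongrightarrow> 0"
    using decay unfolding slow_decay_def by blast
  then have "\<forall>\<^sub>F M in sequentially. f M > - eps"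
    using order_tendstoD(1)[of f 0 _ "- eps"] eps by simp
  then show ?thesis
    using eventually_prufer_phase_ge[OF a decay e(1,2), of K]
      eventually_prufer_phase_le[OF a decay] eventually_gt_at_top[of 0]
  proof eventually_elim
    case (elim M)
    have fM: "f M < 0"
      using neg elim by simp
    have "strict_mono (prufer_phase a (M - 1))"
      by (rule strict_mono_prufer_phase[OF a])
    note mono = strict_mono_less_eq[OF this, THEN iffD1]
    show ?case
    proof (intro allI impI)
      fix x
      assume x: "prufer_phase a (M - 1) x \<in> {pi / 2 + eps..K}"
      have "2 * \<bar>f M\<bar> \<le> x"
        by (rule mono) (use x elim fM in auto)
      moreover have "x \<le> 2 * (1 + e) * \<bar>f M\<bar>"
        by (rule mono) (use x elim in auto)
      ultimately have "1 \<le> x / (2 * \<bar>f M\<bar>)" "x / (2 * \<bar>f M\<bar>) \<le> 1 + e"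
        using fM by (simp_all add: field_simps)
      then show "\<bar>x / (2 * \<bar>f M\<bar>) - 1\<bar> < \<delta>"
        using e by linarith
    qed
  qed
qed

section \<open>Asymptotics of the extreme zeros\<close>

theorem theorem1p1:
  fixes k :: nat and eps \<xi> \<delta> :: real and \<beta> :: complex
    and \<alpha> :: "nat \<Rightarrow> complex" and f :: "nat \<Rightarrow> real"
  assumes "k \<ge> 1"
    and "eps > 0"
    and "\<xi> \<in> {pi / 2 + eps <..< 3 * pi / 2 - eps}"
    and "\<beta> = cis \<xi>"
    and "\<And>n. cmod (\<alpha> n) < 1"
    and "\<And>n. \<alpha> n \<in> \<real>"
    and "slow_decay \<alpha> f"
    and "\<delta> > 0"
  shows "\<exists>N\<ge>k. \<forall>M>N.
           \<bar>Arg2pi (popuc_zero \<alpha> \<beta> M k) / (2 * \<bar>f M\<bar>) - 1\<bar> < \<delta> \<and>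
           \<bar>(2 * pi - Arg2pi (popuc_zero \<alpha> \<beta> M (M - k + 1))) / (2 * \<bar>f M\<bar>) - 1\<bar> < \<delta>"
proof -
  define a where "a n = Re (\<alpha> n)" for n
  have \<alpha>: "\<alpha> = (\<lambda>n. of_real (a n))"
    using assms(6) by (simp add: a_def fun_eq_iff)
  have a: "\<bar>a n\<bar> < 1" for n
    using assms(5)[of n] by (simp add: \<alpha>)
  have \<xi>: "0 < \<xi>" "\<xi> < 2 * pi"
    using assms(2,3) pi_gt_zero by auto
  obtain N where N: "\<And>M x. M \<ge> N \<Longrightarrow> prufer_phase a (M - 1) x \<in> {pi / 2 + eps..2 * pi * real k} \<Longrightarrow>
      \<bar>x / (2 * \<bar>f M\<bar>) - 1\<bar> < \<delta>"
    using eventually_prufer_phase_levels_near[OF a assms(7)[unfolded \<alpha>] assms(2,8), of "2 * pi * real k"]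
    unfolding eventually_sequentially by blast
  have k: "2 * pi * 1 \<le> 2 * pi * real k"
    using assms(1) by (intro mult_left_mono) auto
  show ?thesis
  proof (intro exI[of _ "max N k"] conjI allI impI)
    fix M
    assume M: "M > max N k"
    then obtain n where n: "M = Suc n"
      by (cases M) auto
    show "\<bar>Arg2pi (popuc_zero \<alpha> \<beta> M k) / (2 * \<bar>f M\<bar>) - 1\<bar> < \<delta>"
    proof (rule N)
      have "prufer_phase a (M - 1) (Arg2pi (popuc_zero \<alpha> \<beta> M k)) = 2 * pi * real k - \<xi>"
        using prufer_phase_Arg2pi_popuc_zero[OF a \<xi> assms(1), of n] M by (simp add: n \<alpha> assms(4))
      then show "prufer_phase a (M - 1) (Arg2pi (popuc_zero \<alpha> \<beta> M k)) \<in>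
          {pi / 2 + eps..2 * pi * real k}"
        using k \<xi> assms(3) unfolding atLeastAtMost_iff greaterThanLessThan_iff by linarith
    qed (use M in simp)
    show "\<bar>(2 * pi - Arg2pi (popuc_zero \<alpha> \<beta> M (M - k + 1))) / (2 * \<bar>f M\<bar>) - 1\<bar> < \<delta>"
    proof (rule N)
      have "prufer_phase a (M - 1) (Arg2pi (popuc_zero \<alpha> \<beta> M (M - k + 1))) =
          2 * pi * real (M - k + 1) - \<xi>"
        using prufer_phase_Arg2pi_popuc_zero[OF a \<xi>, of "M - k + 1" n] M assms(1)
        by (simp add: n \<alpha> assms(4))
      then have "prufer_phase a (M - 1) (2 * pi - Arg2pi (popuc_zero \<alpha> \<beta> M (M - k + 1))) =
          2 * pi * real M - (2 * pi * real (M - k + 1) - \<xi>)"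
        using prufer_phase_reflect[of a "M - 1"] by (simp add: n)
      \<comment> \<open>This is the level of the \<open>k\<close>-th zero for the parameter \<open>2 \<pi> - \<xi>\<close> in place of \<open>\<xi>\<close>.\<close>
      also have "\<dots> = 2 * pi * real k - 2 * pi + \<xi>"
        using M by (simp add: of_nat_diff algebra_simps)
      finally show "prufer_phase a (M - 1) (2 * pi - Arg2pi (popuc_zero \<alpha> \<beta> M (M - k + 1))) \<in>
          {pi / 2 + eps..2 * pi * real k}"
        using k \<xi> assms(3) unfolding atLeastAtMost_iff greaterThanLessThan_iff by linarith
    qed (use M in simp)
  qed simp
qed

end
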